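(* Let the parameters be regular, let $\boldsymbol n\in\mathbb N_0^p$, $\boldsymbol m\in\mathbb N_0^q$ with $|\boldsymbol n|=|\boldsymbol m|+1$ and $\boldsymbol m$ near the diagonal, and let the parameters be admissible for $\boldsymbol m$ (see context). Then the index pair $(\boldsymbol n,\boldsymbol m)$ is strongly normal for the $A$-polynomial problem: the space of solutions of the $A$-problem is one-dimensional, and every nonzero solution $\mathbf A=(A^{(1)},\dots,A^{(p)})^{\mathsf T}$ satisfies $\deg A^{(i)}=n_i-1$ for every $i\in\{1,\dots,p\}$ with $n_i\ge1$.
   Context: Notation. $\mathbf 1_d$: all-ones vector; $\boldsymbol e_j$: standard basis vector; $|\boldsymbol n|=\sum n_i$; $\Gamma(\boldsymbol v)=\prod_h\Gamma(v_h)$ (empty product $1$). $\mathbb P_N$: complex polynomials of degree $\le N$, $\mathbb P_{-1}=\{0\}$. $\mathbb T$: positively oriented unit circle. $\mathbb Z_{\le0}=\{0,-1,\dots\}$. Parameters: $p,q\ge1$, $0\le r<q$, $\boldsymbol a\in\mathbb C^r$, $\boldsymbol b\in\mathbb C^q$, $\boldsymbol\kappa\in\mathbb C^p$; regular: $b_j-b_h\notin\mathbb Z$ $(j\ne h)$, $\kappa_i-\kappa_h\notin\mathbb Z$ $(i\ne h)$. Weights: $C_{j,i}(z)=\sum_{k\ge0}\frac{\Gamma((k+\kappa_i)\mathbf 1_r+\boldsymbol a+\mathbf 1_r)}{\Gamma((k+\kappa_i)\mathbf 1_q+\boldsymbol b+\boldsymbol e_j+\mathbf 1_q)}z^{-k-1}$,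 $z\neq0$. $\boldsymbol m$ near the diagonal: $|m_j-m_h|\le1$ for all $j,h$; $m_{\min}=\min_hm_h$, $j_{\min}=\min\{j:m_j=m_{\min}\}$. Admissible for $\boldsymbol m$ (all Gamma factors in the explicit hypergeometric solution formulas, including those defining Pochhammer quotients, finite): for all $i,j,\rho$, $\kappa_i+a_\rho+1\notin\mathbb Z_{\le0}$, $\kappa_i+b_j+1\notin\mathbb Z_{\le0}$; $a_\rho-b_j-m_j+1\notin\mathbb Z_{\le0}$ whenever $m_j\ge1$; $a_\rho-b_{j_{\min}}-m_{\min}\notin\mathbb Z_{\le0}$. $A$-problem for $(\boldsymbol n,\boldsymbol m)$: find column vectors $(A^{(1)},\dots,A^{(p)})^{\mathsf T}$ with $A^{(i)}\in\mathbb P_{n_i-1}$ and $\sum_{i=1}^p\oint_{\mathbb T}z^\ell C_{j,i}(z)A^{(i)}(z)\frac{\mathrm dz}{2\pi\mathrm i}=0$ for $1\le j\le q$, $0\le\ell\le m_j-1$. *)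

theory Defs
  imports "HOL-Complex_Analysis.Complex_Analysis" "HOL-Library.Function_Algebras"
begin

text \<open>
  Vectors of length \<open>d\<close> are functions on \<open>nat\<close> whose values at the indices \<open>1, \<dots>, d\<close> are the
  entries; values at other indices are never used. Lengths may be \<open>0\<close>.
\<close>

definition Gamma_vec :: "nat \<Rightarrow> (nat \<Rightarrow> complex) \<Rightarrow> complex" where
  "Gamma_vec d v = (\<Prod>h=1..d. Gamma (v h))"

definition regular ::
    "nat \<Rightarrow> nat \<Rightarrow> (nat \<Rightarrow> complex) \<Rightarrow> (nat \<Rightarrow> complex) \<Rightarrow> bool" where
  "regular p q b \<kappa> \<longleftrightarrow>
     (\<forall>j\<in>{1..q}. \<forall>h\<in>{1..q}. j \<noteq> h \<longrightarrow> b j - b h \<notin> \<int>) \<and>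
     (\<forall>i\<in>{1..p}. \<forall>h\<in>{1..p}. i \<noteq> h \<longrightarrow> \<kappa> i - \<kappa> h \<notin> \<int>)"

text \<open>
  The weight \<open>C\<^bsub>j,i\<^esub>(z)\<close> for \<open>z \<noteq> 0\<close>. Since \<open>r < q\<close>, the series converges at every such \<open>z\<close>.
\<close>
definition weight ::
    "nat \<Rightarrow> nat \<Rightarrow> (nat \<Rightarrow> complex) \<Rightarrow> (nat \<Rightarrow> complex) \<Rightarrow> (nat \<Rightarrow> complex)
      \<Rightarrow> nat \<Rightarrow> nat \<Rightarrow> complex \<Rightarrow> complex" where
  "weight q r a b \<kappa> j i z =
     (\<Sum>k. Gamma_vec r (\<lambda>\<rho>. of_nat k + \<kappa> i + a \<rho> + 1) /
           Gamma_vec q (\<lambda>h. of_nat k + \<kappa> i + b h + (if h = j then 1 else 0) + 1) *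
           z powi (- int k - 1))"

definition near_diagonal :: "nat \<Rightarrow> (nat \<Rightarrow> nat) \<Rightarrow> bool" where
  "near_diagonal q m \<longleftrightarrow> (\<forall>j\<in>{1..q}. \<forall>h\<in>{1..q}. \<bar>int (m j) - int (m h)\<bar> \<le> 1)"

definition m_min :: "nat \<Rightarrow> (nat \<Rightarrow> nat) \<Rightarrow> nat" where
  "m_min q m = Min (m ` {1..q})"

definition j_min :: "nat \<Rightarrow> (nat \<Rightarrow> nat) \<Rightarrow> nat" where
  "j_min q m = Min {j \<in> {1..q}. m j = m_min q m}"

definition admissible ::
    "nat \<Rightarrow> nat \<Rightarrow> nat \<Rightarrow> (nat \<Rightarrow> complex) \<Rightarrow> (nat \<Rightarrow> complex) \<Rightarrow> (nat \<Rightarrow> complex)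
      \<Rightarrow> (nat \<Rightarrow> nat) \<Rightarrow> bool" where
  "admissible p q r a b \<kappa> m \<longleftrightarrow>
     (\<forall>i\<in>{1..p}. \<forall>\<rho>\<in>{1..r}. \<kappa> i + a \<rho> + 1 \<notin> \<int>\<^sub>\<le>\<^sub>0) \<and>
     (\<forall>i\<in>{1..p}. \<forall>j\<in>{1..q}. \<kappa> i + b j + 1 \<notin> \<int>\<^sub>\<le>\<^sub>0) \<and>
     (\<forall>\<rho>\<in>{1..r}. \<forall>j\<in>{1..q}. m j \<ge> 1 \<longrightarrow> a \<rho> - b j - of_nat (m j) + 1 \<notin> \<int>\<^sub>\<le>\<^sub>0) \<and>
     (\<forall>\<rho>\<in>{1..r}. a \<rho> - b (j_min q m) - of_nat (m_min q m) \<notin> \<int>\<^sub>\<le>\<^sub>0)"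

text \<open>
  The bound is an integer so that \<open>polys_upto (-1) = {0}\<close>; the case \<open>P = 0\<close> is separate because
  \<^term>\<open>degree 0 = 0\<close>.
\<close>
definition polys_upto :: "int \<Rightarrow> complex poly set" where
  "polys_upto N = {P. P = 0 \<or> int (degree P) \<le> N}"

text \<open>
  Entries outside \<open>{1..p}\<close> are required to vanish, so that solutions correspond exactly to
  \<open>p\<close>-tuples of polynomials.
\<close>
definition A_solutions ::
    "nat \<Rightarrow> nat \<Rightarrow> nat \<Rightarrow> (nat \<Rightarrow> complex) \<Rightarrow> (nat \<Rightarrow> complex) \<Rightarrow> (nat \<Rightarrow> complex)
      \<Rightarrow> (nat \<Rightarrow> nat) \<Rightarrow> (nat \<Rightarrow> nat) \<Rightarrow> (nat \<Rightarrow> complex poly) set" where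
  "A_solutions p q r a b \<kappa> n m =
     {A. (\<forall>i. i \<notin> {1..p} \<longrightarrow> A i = 0) \<and>
         (\<forall>i\<in>{1..p}. A i \<in> polys_upto (int (n i) - 1)) \<and>
         (\<forall>j\<in>{1..q}. \<forall>l<m j.
            (\<Sum>i=1..p. contour_integral (circlepath 0 1)
               (\<lambda>z. z ^ l * weight q r a b \<kappa> j i z * poly (A i) z / (2 * of_real pi * \<i>))) = 0)}"

definition tuple_scale :: "complex \<Rightarrow> (nat \<Rightarrow> complex poly) \<Rightarrow> (nat \<Rightarrow> complex poly)" where
  "tuple_scale c A = (\<lambda>i. smult c (A i))"

interpretation poly_tuple: vector_space tuple_scale
  by unfold_locales
    (auto simp: tuple_scale_def fun_eq_iff smult_add_right smult_add_left)

end

theory Submission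
  imports Defs
begin

text \<open>
  Expanding the weights, the \<open>A\<close>-problem becomes a discrete orthogonality on the
  \<open>N + 1 = |n|\<close> distinct nodes \<open>\<kappa>\<^sub>i + s\<close> with \<open>s < n\<^sub>i\<close>. The moment functions are, up to one common
  nowhere vanishing factor, rational in the node, with simple poles among the \<open>N = |m|\<close> points
  \<open>-b\<^sub>h - 1 - t\<close>, \<open>t < m\<^sub>h\<close>; near-diagonality keeps them there and \<open>r < q\<close> makes them vanish at
  infinity. The \<open>(j, l)\<close>-th one has a pole at \<open>-b\<^sub>j - 1 - l\<close> (this is where admissibility
  prevents a cancellation) and otherwise only poles with \<open>t < l\<close>, so by triangularity the
  numerators over the common denominator span all polynomials of degree less than \<open>N\<close>. A
  functional supported on \<open>N + 1\<close> nodes and annihilating these is a multiple of the divided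
  difference, all of whose coefficients are nonzero.
\<close>

section \<open>Polynomial interpolation and divided differences\<close>

lemma degree_prod_linear:
  fixes x :: "'i \<Rightarrow> 'a::field"
  shows "degree (\<Prod>j\<in>J. [:- x j, 1:]) = card J"
  by (subst degree_prod_eq_sum_degree) auto

text \<open>Both sides have degree below \<open>card I\<close> and agree at the
  \<open>card I\<close> distinct points \<open>x i\<close>, where only one summand survives.\<close>

lemma lagrange_interpolation:
  fixes x :: "'i \<Rightarrow> 'a::field"
  assumes "finite I" and inj: "inj_on x I" and deg: "degree P < card I"
  shows "P = (\<Sum>i\<in>I. smult (poly P (x i) / (\<Prod>j\<in>I - {i}. x i - x j))
                        (\<Prod>j\<in>I - {i}. [:- x j, 1:]))" (is "P = (\<Sum>i\<in>I. smult (?c i) (?L i))")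
proof (rule poly_eqI_degree)
  fix y assume "y \<in> x ` I"
  then obtain k where k: "k \<in> I" and y: "y = x k" by auto
  have nz: "(\<Prod>j\<in>I - {k}. x k - x j) \<noteq> 0"
    using \<open>finite I\<close> k inj by (auto simp: inj_on_def)
  have "poly (\<Sum>i\<in>I. smult (?c i) (?L i)) (x k) = (\<Sum>i\<in>I. ?c i * (\<Prod>j\<in>I - {i}. x k - x j))"
    by (simp add: poly_sum poly_prod)
  also have "\<dots> = (\<Sum>i\<in>{k}. ?c i * (\<Prod>j\<in>I - {i}. x k - x j))"
  proof (rule sum.mono_neutral_right)
    show "\<forall>i\<in>I - {k}. ?c i * (\<Prod>j\<in>I - {i}. x k - x j) = 0"
      using \<open>finite I\<close> k by (auto intro!: prod_zero)
  qed (use \<open>finite I\<close> k in auto)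
  also have "\<dots> = poly P (x k)" using nz by simp
  finally show "poly P y = poly (\<Sum>i\<in>I. smult (?c i) (?L i)) y" by (simp add: y)
next
  show "degree P < card (x ` I)" using deg inj by (simp add: card_image)
next
  have "degree (?L i) \<le> card I - 1" if "i \<in> I" for i
    using that \<open>finite I\<close> by (simp add: degree_prod_linear)
  then have "degree (\<Sum>i\<in>I. smult (?c i) (?L i)) \<le> card I - 1"
    by (intro degree_sum_le \<open>finite I\<close>) (auto intro: order_trans[OF degree_smult_le])
  then show "degree (\<Sum>i\<in>I. smult (?c i) (?L i)) < card (x ` I)"
    using deg inj by (simp add: card_image)
qed

text \<open>The weights on the right are those of the divided difference of order \<open>N\<close>.
  It annihilates lower degrees since it reads off the coefficient at degree \<open>N\<close>;
  conversely, test polynomials vanishing at all but two nodes tie any two values of \<open>v\<close>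
  together.\<close>

lemma annihilates_low_degree_iff:
  fixes x v :: "'i \<Rightarrow> 'a::field"
  assumes "finite I" and inj: "inj_on x I" and card: "card I = Suc N"
  shows "(\<forall>P. degree P < N \<longrightarrow> (\<Sum>i\<in>I. v i * poly P (x i)) = 0) \<longleftrightarrow>
         (\<exists>c. \<forall>i\<in>I. v i = c / (\<Prod>j\<in>I - {i}. x i - x j))"
proof
  assume ann: "\<forall>P. degree P < N \<longrightarrow> (\<Sum>i\<in>I. v i * poly P (x i)) = 0"
  let ?W = "\<lambda>i. \<Prod>j\<in>I - {i}. x i - x j"
  have nz: "?W i \<noteq> 0" if "i \<in> I" for i
    using \<open>finite I\<close> that inj by (auto simp: inj_on_def)
  \<comment> \<open>A reference node: the constant \<open>c\<close> will be
    \<open>v k * ?W k\<close>.\<close>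
  obtain k where k: "k \<in> I" using card by fastforce
  have "v i * ?W i = v k * ?W k" if i: "i \<in> I" for i
  proof (cases "i = k")
    case False
    \<comment> \<open>Of degree \<open>N - 1\<close>, vanishing at every node except
      \<open>x i\<close> and \<open>x k\<close>, so the annihilation condition reduces to two
      terms.\<close>
    define P where "P = (\<Prod>j\<in>I - {i, k}. [:- x j, 1:])"
    have cI: "card (I - {i, k}) = card I - 2"
      using \<open>finite I\<close> i k False by (simp add: card_Diff_subset)
    have "card I \<ge> card {i, k}"
      by (rule card_mono) (use \<open>finite I\<close> i k in auto)
    then have "card I \<ge> 2" using False by simp
    then have "degree P < N"
      using cI card by (simp add: P_def degree_prod_linear)
    then have "0 = (\<Sum>l\<in>I. v l * poly P (x l))" using ann by simp
    also have "\<dots> = (\<Sum>l\<in>{i, k}. v l * poly P (x l))"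
      by (rule sum.mono_neutral_right)
         (use \<open>finite I\<close> i k in \<open>auto simp: P_def poly_prod intro!: prod_zero\<close>)
    also have "\<dots> = v i * poly P (x i) + v k * poly P (x k)" using False by simp
    finally have eq: "v i * poly P (x i) = - (v k * poly P (x k))"
      by (simp add: eq_neg_iff_add_eq_0)
    have split: "?W s = (x s - x t) * (\<Prod>j\<in>I - {s, t}. x s - x j)" if "t \<in> I" "t \<noteq> s" for s t
    proof -
      have "I - {s} - {t} = I - {s, t}" by blast
      then show ?thesis using prod.remove[of "I - {s}" t "\<lambda>j. x s - x j"] that \<open>finite I\<close> by simp
    qed
    have Wi: "?W i = (x i - x k) * poly P (x i)"
      using split[of k i] k False by (simp add: P_def poly_prod)
    have Wk: "?W k = (x k - x i) * poly P (x k)"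
      using split[of i k] i False by (simp add: P_def poly_prod insert_commute)
    have "v i * ?W i = (x i - x k) * (v i * poly P (x i))" unfolding Wi by (simp add: mult_ac)
    also have "\<dots> = v k * ?W k" unfolding eq Wk by (simp add: algebra_simps)
    finally show ?thesis .
  qed simp
  then have "\<forall>i\<in>I. v i = v k * ?W k / ?W i" using nz by (simp add: field_simps)
  then show "\<exists>c. \<forall>i\<in>I. v i = c / ?W i" by blast
next
  assume "\<exists>c. \<forall>i\<in>I. v i = c / (\<Prod>j\<in>I - {i}. x i - x j)"
  then obtain c where c: "\<And>i. i \<in> I \<Longrightarrow> v i = c / (\<Prod>j\<in>I - {i}. x i - x j)" by blast
  show "\<forall>P. degree P < N \<longrightarrow> (\<Sum>i\<in>I. v i * poly P (x i)) = 0"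
  proof (intro allI impI)
    fix P :: "'a poly" assume deg: "degree P < N"
    have lc: "coeff (\<Prod>j\<in>I - {i}. [:- x j, 1:]) N = 1" if "i \<in> I" for i
    proof -
      have "degree (\<Prod>j\<in>I - {i}. [:- x j, 1:]) = N"
        using that card \<open>finite I\<close> by (simp add: degree_prod_linear)
      then show ?thesis using lead_coeff_prod[of "\<lambda>j. [:- x j, 1:]" "I - {i}"] by simp
    qed
    \<comment> \<open>The coefficient at degree \<open>N\<close> is compared on both sides of the
      Lagrange formula, whose basis products are monic of degree \<open>N\<close>.\<close>
    have "0 = coeff P N" using deg by (simp add: coeff_eq_0)
    also have "P = (\<Sum>i\<in>I. smult (poly P (x i) / (\<Prod>j\<in>I - {i}. x i - x j))
                        (\<Prod>j\<in>I - {i}. [:- x j, 1:]))"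
      by (rule lagrange_interpolation) (use assms deg in auto)
    also have "coeff \<dots> N = (\<Sum>i\<in>I. poly P (x i) / (\<Prod>j\<in>I - {i}. x i - x j))"
      by (simp add: coeff_sum lc)
    finally have "0 = c * (\<Sum>i\<in>I. poly P (x i) / (\<Prod>j\<in>I - {i}. x i - x j))" by simp
    also have "\<dots> = (\<Sum>i\<in>I. v i * poly P (x i))" by (simp add: sum_distrib_left c)
    finally show "(\<Sum>i\<in>I. v i * poly P (x i)) = 0" by simp
  qed
qed

text \<open>The evaluations of \<open>Q\<close> at the points \<open>y\<close> form a triangular matrix, graded by \<open>lev\<close>.\<close>
lemma triangular_annihilator:
  fixes y :: "'j \<Rightarrow> 'a::field" and x v :: "'i \<Rightarrow> 'a" and lev :: "'j \<Rightarrow> nat"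
  assumes "finite J" and inj: "inj_on y J"
    and deg: "\<And>j. j \<in> J \<Longrightarrow> degree (Q j) < card J"
    and diag: "\<And>j. j \<in> J \<Longrightarrow> poly (Q j) (y j) \<noteq> 0"
    and upper: "\<And>j k. j \<in> J \<Longrightarrow> k \<in> J \<Longrightarrow> k \<noteq> j \<Longrightarrow> lev j \<le> lev k \<Longrightarrow> poly (Q j) (y k) = 0"
    and ann: "\<And>j. j \<in> J \<Longrightarrow> (\<Sum>i\<in>I. v i * poly (Q j) (x i)) = 0"
    and P: "degree P < card J"
  shows "(\<Sum>i\<in>I. v i * poly P (x i)) = 0"
proof -
  let ?W = "\<lambda>j. \<Prod>k\<in>J - {j}. y j - y k"
  let ?L = "\<lambda>j. \<Prod>k\<in>J - {j}. [:- y k, 1:]"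
  let ?\<Lambda> = "\<lambda>P. \<Sum>i\<in>I. v i * poly P (x i)"
  have expand: "?\<Lambda> P = (\<Sum>j\<in>J. poly P (y j) / ?W j * ?\<Lambda> (?L j))" if "degree P < card J" for P
  proof -
    have "?\<Lambda> P = ?\<Lambda> (\<Sum>j\<in>J. smult (poly P (y j) / ?W j) (?L j))"
      using lagrange_interpolation[OF \<open>finite J\<close> inj that] by simp
    also have "\<dots> = (\<Sum>j\<in>J. poly P (y j) / ?W j * ?\<Lambda> (?L j))"
      by (simp add: poly_sum sum_distrib_left sum_distrib_right mult_ac sum.swap[of _ J])
    finally show ?thesis .
  qed
  have L: "?\<Lambda> (?L j) = 0" if "j \<in> J" for j
    using that
  \<comment> \<open>In the Lagrange expansion of \<open>Q j\<close>, \<open>upper\<close> removes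
    the other indices of level at least \<open>lev j\<close> and the induction hypothesis those of
    lower level. Only the term at \<open>j\<close> remains, with nonzero factor by
    \<open>diag\<close>.\<close>
  proof (induction "lev j" arbitrary: j rule: less_induct)
    case less
    have "0 = ?\<Lambda> (Q j)" using ann less.prems by simp
    also have "\<dots> = (\<Sum>k\<in>J. poly (Q j) (y k) / ?W k * ?\<Lambda> (?L k))"
      using expand deg less.prems by simp
    also have "\<dots> = (\<Sum>k\<in>{j}. poly (Q j) (y k) / ?W k * ?\<Lambda> (?L k))"
    proof (rule sum.mono_neutral_right)
      show "\<forall>k\<in>J - {j}. poly (Q j) (y k) / ?W k * ?\<Lambda> (?L k) = 0"
      proof
        fix k assume k: "k \<in> J - {j}"
        show "poly (Q j) (y k) / ?W k * ?\<Lambda> (?L k) = 0"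
        proof (cases "lev j \<le> lev k")
          case True then show ?thesis using upper[of j k] k less.prems by simp
        next
          case False then show ?thesis using less.hyps[of k] k by simp
        qed
      qed
    qed (use \<open>finite J\<close> less.prems in auto)
    finally have "poly (Q j) (y j) / ?W j * ?\<Lambda> (?L j) = 0" by simp
    moreover have "?W j \<noteq> 0" using \<open>finite J\<close> less.prems inj by (auto simp: inj_on_def)
    ultimately show ?case using diag[OF less.prems] by simp
  qed
  show ?thesis unfolding expand[OF P] by (rule sum.neutral) (simp add: L)
qed

section \<open>Contour integrals over the unit circle\<close>

lemma higher_deriv_poly: "(deriv ^^ k) (poly P) = poly ((pderiv ^^ k) P)" for P :: "complex poly"
  by (induction k) (auto intro!: DERIV_imp_deriv poly_DERIV)

text \<open>Cauchy's formula for the \<open>k\<close>-th derivative at 0, which for a polynomial is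
  \<open>fact k * coeff P k\<close>.\<close>

lemma has_contour_integral_poly_over_power:
  "((\<lambda>z. poly P z / z ^ Suc k) has_contour_integral 2 * of_real pi * \<i> * coeff P k) (circlepath 0 1)"
proof -
  have "((\<lambda>z. poly P z / (z - 0) ^ Suc k) has_contour_integral
          (2 * pi * \<i>) / fact k * (deriv ^^ k) (poly P) 0) (circlepath 0 1)"
    by (rule Cauchy_has_contour_integral_higher_derivative_circlepath)
       (auto intro!: continuous_intros holomorphic_intros)
  also have "(deriv ^^ k) (poly P) 0 = fact k * coeff P k"
    by (simp add: higher_deriv_poly poly_0_coeff_0 coeff_higher_pderiv pochhammer_fact)
  finally show ?thesis by (simp add: mult.assoc)
qed

text \<open>On the unit circle the series converges uniformly by the Weierstrass M-test, so it may
  be integrated termwise. Each term contributes one coefficient of \<open>P\<close>, hence the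
  partial integrals are constant from \<open>N\<close> on.\<close>

lemma contour_integral_series_times_poly:
  fixes w :: "nat \<Rightarrow> complex"
  assumes "summable (\<lambda>k. norm (w k))" and "\<And>k. k \<ge> N \<Longrightarrow> coeff P k = 0"
  shows "contour_integral (circlepath 0 1) (\<lambda>z. (\<Sum>k. w k * z powi (- int k - 1)) * poly P z) =
           2 * of_real pi * \<i> * (\<Sum>k<N. w k * coeff P k)"
proof -
  let ?C = "circlepath 0 1"
  let ?f = "\<lambda>K z. \<Sum>k<K. w k * (poly P z / z ^ Suc k)"
  have int: "(?f K has_contour_integral (\<Sum>k<K. w k * (2 * of_real pi * \<i> * coeff P k))) ?C" for K
    by (intro has_contour_integral_sum has_contour_integral_lmul has_contour_integral_poly_over_power) auto
  have "bounded (poly P ` sphere 0 1)"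
    by (intro compact_imp_bounded compact_continuous_image continuous_intros) auto
  then obtain B where B: "\<And>z. norm z = 1 \<Longrightarrow> norm (poly P z) \<le> B"
    unfolding bounded_iff by (metis imageI mem_sphere_0)
  have "uniform_limit (sphere 0 1) ?f (\<lambda>z. \<Sum>k. w k * (poly P z / z ^ Suc k)) sequentially"
  proof (rule Weierstrass_m_test)
    show "norm (w k * (poly P z / z ^ Suc k)) \<le> norm (w k) * B" if "z \<in> sphere 0 1" for k z
      using that B[of z] by (auto simp: norm_mult norm_divide norm_power intro!: mult_left_mono)
    show "summable (\<lambda>k. norm (w k) * B)" by (intro summable_mult2 assms)
  qed
  moreover have "(\<Sum>k. w k * (poly P z / z ^ Suc k)) = (\<Sum>k. w k * z powi (- int k - 1)) * poly P z"
    if "z \<in> sphere 0 1" for z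
  proof -
    have z: "norm z = 1" using that by simp
    have e: "z powi (- int k - 1) = 1 / z ^ Suc k" for k
    proof -
      have "- int k - 1 = - int (Suc k)" by simp
      then show ?thesis by (simp only: power_int_minus power_int_of_nat inverse_eq_divide)
    qed
    have "summable (\<lambda>k. w k * z powi (- int k - 1))"
      by (rule summable_norm_cancel) (use assms z in \<open>simp add: e norm_mult norm_divide norm_power\<close>)
    then have "(\<Sum>k. w k * z powi (- int k - 1)) * poly P z = (\<Sum>k. w k * z powi (- int k - 1) * poly P z)"
      by (rule suminf_mult2)
    then show ?thesis by (simp add: e)
  qed
  ultimately have "uniform_limit (sphere 0 1) ?f (\<lambda>z. (\<Sum>k. w k * z powi (- int k - 1)) * poly P z) sequentially"
    by (subst uniform_limit_cong') auto
  then have "((\<lambda>K. contour_integral ?C (?f K)) \<longlongrightarrow>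
       contour_integral ?C (\<lambda>z. (\<Sum>k. w k * z powi (- int k - 1)) * poly P z)) sequentially"
    by (intro contour_integral_uniform_limit_circlepath)
       (use int in \<open>auto simp: contour_integrable_on_def intro!: always_eventually\<close>)
  moreover have "((\<lambda>K. contour_integral ?C (?f K)) \<longlongrightarrow>
       2 * of_real pi * \<i> * (\<Sum>k<N. w k * coeff P k)) sequentially"
  proof (rule tendsto_eventually, rule eventually_sequentiallyI)
    fix K assume K: "N \<le> K"
    have "contour_integral ?C (?f K) = (\<Sum>k<K. w k * (2 * of_real pi * \<i> * coeff P k))"
      by (rule contour_integral_unique[OF int])
    also have "\<dots> = (\<Sum>k<N. w k * (2 * of_real pi * \<i> * coeff P k))"
      by (rule sum.mono_neutral_right) (use K assms(2) in auto)
    finally show "contour_integral ?C (?f K) = 2 * of_real pi * \<i> * (\<Sum>k<N. w k * coeff P k)"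
      by (simp add: sum_distrib_left mult_ac)
  qed
  ultimately show ?thesis by (rule LIMSEQ_unique)
qed

section \<open>Gamma quotients and convergence of the weights\<close>

text \<open>The Laurent coefficients of the weight, with \<open>k + \<kappa> i\<close> replaced by a
  complex variable \<open>x\<close>. A factor \<open>z ^ l\<close> then becomes a shift of
  \<open>x\<close> by \<open>l\<close>.\<close>

definition weight_coeff ::
    "nat \<Rightarrow> nat \<Rightarrow> (nat \<Rightarrow> complex) \<Rightarrow> (nat \<Rightarrow> complex) \<Rightarrow> nat \<Rightarrow> complex \<Rightarrow> complex" where
  "weight_coeff q r a b j x =
     Gamma_vec r (\<lambda>\<rho>. x + a \<rho> + 1) / Gamma_vec q (\<lambda>h. x + b h + (if h = j then 1 else 0) + 1)"

text \<open>The functional equation of Gamma, iterated \<open>k h\<close> times in each entry. At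
  its poles \<open>Gamma\<close> has the default value 0, where the identity can fail.\<close>

lemma Gamma_vec_add:
  assumes "\<And>h. h \<in> {1..d} \<Longrightarrow> v h \<notin> \<int>\<^sub>\<le>\<^sub>0"
  shows "Gamma_vec d (\<lambda>h. v h + of_nat (k h)) = (\<Prod>h=1..d. pochhammer (v h) (k h)) * Gamma_vec d v"
  using assms by (simp add: Gamma_vec_def pochhammer_Gamma Gamma_eq_zero_iff flip: prod.distrib)

lemma Gamma_vec_nonzero:
  assumes "\<And>h. h \<in> {1..d} \<Longrightarrow> v h \<notin> \<int>\<^sub>\<le>\<^sub>0"
  shows "Gamma_vec d v \<noteq> 0"
  using assms by (simp add: Gamma_vec_def Gamma_eq_zero_iff)

lemma add_of_nat_notin_nonpos_Ints:
  fixes z :: complex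
  shows "z \<notin> \<int>\<^sub>\<le>\<^sub>0 \<Longrightarrow> z + of_nat k \<notin> \<int>\<^sub>\<le>\<^sub>0"
  using nonpos_Ints_diff_Nats[of "z + of_nat k" "of_nat k"] by auto

lemma filterlim_of_nat_add_at_infinity:
  "filterlim (\<lambda>k. of_nat k + c :: complex) at_infinity sequentially"
  by (rule tendsto_add_filterlim_at_infinity'[OF tendsto_of_nat tendsto_const])

lemma tendsto_inverse_of_nat_add: "(\<lambda>k. inverse (of_nat k + c :: complex)) \<longlonglongrightarrow> 0"
  by (rule filterlim_compose[OF tendsto_inverse_0 filterlim_of_nat_add_at_infinity])

lemma tendsto_of_nat_add_ratio: "(\<lambda>k. (of_nat k + c) / (of_nat k + d :: complex)) \<longlonglongrightarrow> 1"
proof -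
  have "(\<lambda>k. 1 + (c - d) * inverse (of_nat k + d)) \<longlonglongrightarrow> 1 + (c - d) * 0"
    by (intro tendsto_intros tendsto_inverse_of_nat_add)
  moreover have "\<forall>\<^sub>F k in sequentially. (of_nat k + d :: complex) \<noteq> 0"
    using filterlim_of_nat_add_at_infinity by (rule filterlim_at_infinity_imp_eventually_ne)
  then have "\<forall>\<^sub>F k in sequentially. 1 + (c - d) * inverse (of_nat k + d) = (of_nat k + c) / (of_nat k + d)"
    by eventually_elim (simp add: field_simps)
  ultimately show ?thesis by (simp add: tendsto_cong)
qed

text \<open>The numerator factors pair off with the first \<open>r\<close> denominator factors, each
  ratio tending to 1. At least one reciprocal factor is left over, and it tends to 0.\<close>

lemma tendsto_prod_ratio_zero:
  fixes \<alpha> \<beta> :: "nat \<Rightarrow> complex"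
  assumes "r < q"
  shows "(\<lambda>k. (\<Prod>\<rho>=1..r. of_nat k + \<alpha> \<rho>) / (\<Prod>h=1..q. of_nat k + \<beta> h)) \<longlonglongrightarrow> 0"
proof -
  have "(\<lambda>k. (\<Prod>h=1..r. (of_nat k + \<alpha> h) / (of_nat k + \<beta> h)) * (\<Prod>h=Suc r..q. inverse (of_nat k + \<beta> h)))
          \<longlonglongrightarrow> (\<Prod>h=1..r. 1) * (\<Prod>h=Suc r..q. 0)"
    by (intro tendsto_intros tendsto_of_nat_add_ratio tendsto_inverse_of_nat_add)
  moreover have "(\<Prod>h=1..q. f h) = (\<Prod>h=1..r. f h) * (\<Prod>h=Suc r..q. f h)" for f :: "nat \<Rightarrow> complex"
    using prod.ub_add_nat[of 1 r f "q - r"] assms by simp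
  ultimately show ?thesis
    using assms by (simp add: prod_dividef prod_inversef[symmetric] field_simps power_0_left)
qed

text \<open>Ratio test: by the functional equation of Gamma, consecutive terms differ by a quotient
  of \<open>r\<close> by \<open>q\<close> linear factors, which tends to 0.\<close>

lemma summable_weight_coeff:
  assumes "r < q"
    and a: "\<And>\<rho>. \<rho> \<in> {1..r} \<Longrightarrow> x + a \<rho> + 1 \<notin> \<int>\<^sub>\<le>\<^sub>0"
    and b: "\<And>h. h \<in> {1..q} \<Longrightarrow> x + b h + 1 \<notin> \<int>\<^sub>\<le>\<^sub>0"
  shows "summable (\<lambda>k. norm (weight_coeff q r a b j (of_nat k + x)))"
proof -
  let ?w = "\<lambda>k. weight_coeff q r a b j (of_nat k + x)"
  let ?\<alpha> = "\<lambda>\<rho>. x + a \<rho> + 1" and ?\<beta> = "\<lambda>h. x + b h + (if h = j then 1 else 0) + 1"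
  let ?R = "\<lambda>k. (\<Prod>\<rho>=1..r. of_nat k + ?\<alpha> \<rho>) / (\<Prod>h=1..q. of_nat k + ?\<beta> h)"
  have b': "?\<beta> h \<notin> \<int>\<^sub>\<le>\<^sub>0" if "h \<in> {1..q}" for h
    using b[OF that] add_of_nat_notin_nonpos_Ints[of "x + b h + 1" 1] by (auto simp: add_ac)
  have step: "?w (Suc k) = ?R k * ?w k" for k
  proof -
    have "Gamma_vec r (\<lambda>\<rho>. of_nat (Suc k) + x + a \<rho> + 1) =
            (\<Prod>\<rho>=1..r. of_nat k + ?\<alpha> \<rho>) * Gamma_vec r (\<lambda>\<rho>. of_nat k + x + a \<rho> + 1)"
      using Gamma_vec_add[of r "\<lambda>\<rho>. of_nat k + x + a \<rho> + 1" "\<lambda>_. 1"]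
        add_of_nat_notin_nonpos_Ints[OF a, of _ k] by (simp add: add_ac)
    moreover have "Gamma_vec q (\<lambda>h. of_nat (Suc k) + x + b h + (if h = j then 1 else 0) + 1) =
            (\<Prod>h=1..q. of_nat k + ?\<beta> h) * Gamma_vec q (\<lambda>h. of_nat k + x + b h + (if h = j then 1 else 0) + 1)"
      using Gamma_vec_add[of q "\<lambda>h. of_nat k + x + b h + (if h = j then 1 else 0) + 1" "\<lambda>_. 1"]
        add_of_nat_notin_nonpos_Ints[OF b', of _ k] by (simp add: add_ac)
    ultimately show ?thesis unfolding weight_coeff_def by simp
  qed
  have "(\<lambda>k. norm (?R k)) \<longlonglongrightarrow> 0"
    using tendsto_prod_ratio_zero[OF \<open>r < q\<close>] by (rule tendsto_norm_zero)
  then have "\<forall>\<^sub>F k in sequentially. norm (?R k) < 1 / 2" by (rule order_tendstoD) simp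
  then obtain N where N: "\<And>k. k \<ge> N \<Longrightarrow> norm (?R k) < 1 / 2"
    by (auto simp: eventually_sequentially)
  show ?thesis
  proof (rule summable_ratio_test)
    show "norm (norm (?w (Suc k))) \<le> 1 / 2 * norm (norm (?w k))" if "k \<ge> N" for k
      unfolding step norm_mult using mult_right_mono[OF less_imp_le[OF N[OF that]] norm_ge_zero[of "?w k"]]
      by (simp only: abs_mult real_norm_def abs_norm_cancel)
  qed simp
qed

text \<open>The coefficient of \<open>z ^ s\<close> in \<open>P\<close> becomes that of
  \<open>z ^ (l + s)\<close> in \<open>z ^ l * P\<close>, so it meets the weight coefficient of
  index \<open>l + s\<close>.\<close>

lemma contour_integral_weight:
  assumes "r < q"
    and a: "\<And>\<rho>. \<rho> \<in> {1..r} \<Longrightarrow> \<kappa> i + a \<rho> + 1 \<notin> \<int>\<^sub>\<le>\<^sub>0"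
    and b: "\<And>h. h \<in> {1..q} \<Longrightarrow> \<kappa> i + b h + 1 \<notin> \<int>\<^sub>\<le>\<^sub>0"
    and P: "\<And>s. s \<ge> n \<Longrightarrow> coeff P s = 0"
  shows "contour_integral (circlepath 0 1)
           (\<lambda>z. z ^ l * weight q r a b \<kappa> j i z * poly P z / (2 * of_real pi * \<i>)) =
         (\<Sum>s<n. coeff P s * weight_coeff q r a b j (of_nat l + (\<kappa> i + of_nat s)))"
proof -
  let ?w = "\<lambda>k. weight_coeff q r a b j (of_nat k + \<kappa> i)"
  \<comment> \<open>Absorbs both \<open>z ^ l\<close> and the normalisation of the integral into the
    polynomial.\<close>
  define T where "T = smult (1 / (2 * of_real pi * \<i>)) (monom 1 l * P)"
  have coeff_T: "coeff T k = (if k < l then 0 else coeff P (k - l) / (2 * of_real pi * \<i>))" for k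
    by (simp add: T_def coeff_monom_mult)
  have "(\<lambda>z. z ^ l * weight q r a b \<kappa> j i z * poly P z / (2 * of_real pi * \<i>)) =
        (\<lambda>z. (\<Sum>k. ?w k * z powi (- int k - 1)) * poly T z)"
    by (simp add: weight_def weight_coeff_def T_def poly_monom mult_ac)
  then have "contour_integral (circlepath 0 1)
           (\<lambda>z. z ^ l * weight q r a b \<kappa> j i z * poly P z / (2 * of_real pi * \<i>)) =
        2 * of_real pi * \<i> * (\<Sum>k<l + n. ?w k * coeff T k)"
    using contour_integral_series_times_poly[OF summable_weight_coeff[OF \<open>r < q\<close> a b],
        where N = "l + n" and P = T] P
    by (simp add: coeff_T)
  \<comment> \<open>\<open>T\<close> has no coefficients below \<open>l\<close>, so the sum can be
    reindexed by \<open>k = l + s\<close>.\<close>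
  also have "(\<Sum>k<l + n. ?w k * coeff T k) = (\<Sum>k\<in>(+) l ` {..<n}. ?w k * coeff T k)"
  proof (rule sum.mono_neutral_right)
    have "k \<in> (+) l ` {..<n}" if "k < l + n" "l \<le> k" for k
      using that by (intro image_eqI[of _ _ "k - l"]) auto
    then show "\<forall>k\<in>{..<l + n} - (+) l ` {..<n}. ?w k * coeff T k = 0"
      by (force simp: coeff_T)
  qed auto
  also have "\<dots> = (\<Sum>s<n. ?w (l + s) * (coeff P s / (2 * of_real pi * \<i>)))"
    by (simp add: sum.reindex coeff_T)
  also have "2 * of_real pi * \<i> * \<dots> = (\<Sum>s<n. coeff P s * weight_coeff q r a b j (of_nat l + (\<kappa> i + of_nat s)))"
    by (simp add: sum_distrib_left add_ac mult_ac)
  finally show ?thesis .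
qed

section \<open>Coefficient form of degree bounds, and distinct lattice points\<close>

text \<open>The coefficient form treats the zero polynomial and \<open>n = 0\<close> uniformly,
  without the convention \<open>degree 0 = 0\<close>.\<close>

lemma polys_upto_iff: "P \<in> polys_upto (int n - 1) \<longleftrightarrow> (\<forall>s\<ge>n. coeff P s = 0)"
proof (cases "P = 0")
  case False
  have "degree P < n" if "\<forall>s\<ge>n. coeff P s = 0"
    using that False leading_coeff_0_iff[of P] not_le by blast
  then show ?thesis using False by (auto simp: polys_upto_def coeff_eq_0)
qed (simp add: polys_upto_def)

text \<open>Different \<open>i\<close> give different cosets of the integers, and within a coset the
  offset decides. This serves both the nodes, through \<open>\<kappa>\<close>, and the poles,
  through \<open>b\<close>.\<close>

lemma inj_on_shifted_lattice:
  fixes c :: "nat \<Rightarrow> complex"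
  assumes "\<And>i h. i \<in> I \<Longrightarrow> h \<in> I \<Longrightarrow> i \<noteq> h \<Longrightarrow> c i - c h \<notin> \<int>"
  shows "inj_on (\<lambda>(i, s). c i + of_nat s) (Sigma I S)"
proof (rule inj_onI, clarify)
  fix i s h t assume *: "i \<in> I" "h \<in> I" "c i + of_nat s = c h + of_nat t"
  then have "c i - c h = of_int (int t - int s)" by (simp add: field_simps)
  then have "i = h" using assms[of i h] * Ints_of_int by metis
  then show "i = h \<and> s = t" using * by simp
qed

section \<open>Nodes, poles and moment functions\<close>

locale hypergeometric_A_problem =
  fixes p q r :: nat
    and a b \<kappa> :: "nat \<Rightarrow> complex"
    and n m :: "nat \<Rightarrow> nat"
  assumes r_less_q: "r < q"
    and regular: "regular p q b \<kappa>"
    and sum_n: "(\<Sum>i=1..p. n i) = (\<Sum>j=1..q. m j) + 1"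
    and near_diagonal: "near_diagonal q m"
    and admissible: "admissible p q r a b \<kappa> m"
begin

text \<open>The pair \<open>(i, s)\<close> stands for the unknown coefficient of
  \<open>z ^ s\<close> in the \<open>i\<close>-th polynomial.\<close>

definition nodes :: "(nat \<times> nat) set" where
  "nodes = (SIGMA i:{1..p}. {..<n i})"

definition node :: "nat \<times> nat \<Rightarrow> complex" where
  "node = (\<lambda>(i, s). \<kappa> i + of_nat s)"

text \<open>The poles share their index set with the orthogonality conditions \<open>(j, l)\<close>.\<close>
definition poles :: "(nat \<times> nat) set" where
  "poles = (SIGMA h:{1..q}. {..<m h})"

definition pole :: "nat \<times> nat \<Rightarrow> complex" where
  "pole = (\<lambda>(h, t). - (b h + 1 + of_nat t))"

text \<open>Indexes the linear factors of the denominator Pochhammer symbols produced by the shift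
  by \<open>l\<close>; the unit vector in the weight gives the one extra factor at
  \<open>h = j\<close>.\<close>

definition moment_poles :: "nat \<times> nat \<Rightarrow> (nat \<times> nat) set" where
  "moment_poles = (\<lambda>(j, l). SIGMA h:{1..q}. {..<l + (if h = j then 1 else 0)})"

text \<open>The first product collects the numerator Pochhammer symbols
  \<open>pochhammer (x + a \<rho> + 1) l\<close>; the second extends the denominator to the common
  one over all of \<open>poles\<close>.\<close>

definition moment_numerator :: "nat \<times> nat \<Rightarrow> complex poly" where
  "moment_numerator jl =
     (\<Prod>\<rho>=1..r. \<Prod>t<snd jl. [:a \<rho> + 1 + of_nat t, 1:]) *
     (\<Prod>k\<in>poles - moment_poles jl. [:- pole k, 1:])"

definition common_factor :: "complex \<Rightarrow> complex" where
  "common_factor x =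
     Gamma_vec r (\<lambda>\<rho>. x + a \<rho> + 1) / Gamma_vec q (\<lambda>h. x + b h + 1) / (\<Prod>k\<in>poles. x - pole k)"

lemma finite_nodes: "finite nodes" and finite_poles: "finite poles"
  and finite_moment_poles: "finite (moment_poles jl)"
  by (auto simp: nodes_def poles_def moment_poles_def split: prod.splits)

lemma card_nodes: "card nodes = Suc (card poles)"
  using sum_n by (simp add: nodes_def poles_def)

lemma inj_node: "inj_on node nodes"
  unfolding node_def nodes_def
  by (rule inj_on_shifted_lattice) (use regular in \<open>auto simp: regular_def\<close>)

lemma inj_pole: "inj_on pole poles"
proof -
  have "inj_on (\<lambda>(h, t). b h + of_nat t) poles"
    unfolding poles_def by (rule inj_on_shifted_lattice) (use regular in \<open>auto simp: regular_def\<close>)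
  moreover have "(\<lambda>(h, t). b h + of_nat t) = (\<lambda>k. - pole k - 1)"
    by (auto simp: pole_def)
  ultimately show ?thesis by (auto simp: inj_on_def)
qed

text \<open>Near-diagonality gives \<open>l < m j \<le> m h + 1\<close>, hence
  \<open>l \<le> m h\<close> for each \<open>h\<close>; for \<open>h = j\<close> even
  \<open>l + 1 \<le> m j\<close>.\<close>

lemma moment_poles_subset:
  assumes "jl \<in> poles"
  shows "moment_poles jl \<subseteq> poles"
proof -
  obtain j l where jl: "jl = (j, l)" "j \<in> {1..q}" "l < m j" using assms by (auto simp: poles_def)
  have "m j \<le> m h + 1" if "h \<in> {1..q}" for h
    using near_diagonal jl(2) that unfolding near_diagonal_def by fastforce
  then have "l + (if h = j then 1 else 0) \<le> m h" if "h \<in> {1..q}" for h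
    using jl(3) that by fastforce
  then show ?thesis by (fastforce simp: jl(1) moment_poles_def poles_def)
qed

lemma card_moment_poles: "(j, l) \<in> poles \<Longrightarrow> card (moment_poles (j, l)) = q * l + 1"
  by (simp add: moment_poles_def poles_def sum.distrib)

text \<open>The degree is at most \<open>r * l + card poles - (q * l + 1)\<close>, and
  \<open>r < q\<close>.\<close>

lemma degree_moment_numerator:
  assumes "jl \<in> poles"
  shows "degree (moment_numerator jl) < card poles"
proof -
  obtain j l where jl: "jl = (j, l)" by (cases jl)
  have "degree (moment_numerator jl) \<le> r * l + (card poles - card (moment_poles jl))"
  proof -
    have "degree (\<Prod>\<rho>=1..r. \<Prod>t<l. [:a \<rho> + 1 + of_nat t, 1:]) = r * l"
      by (subst degree_prod_sum_eq; simp add: degree_prod_sum_eq)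
    moreover have "degree (\<Prod>k\<in>poles - moment_poles jl. [:- pole k, 1:]) =
        card poles - card (moment_poles jl)"
      using moment_poles_subset[OF assms] finite_moment_poles by (simp add: degree_prod_linear card_Diff_subset)
    ultimately show ?thesis unfolding moment_numerator_def jl by (metis degree_mult_le snd_conv)
  qed
  \<comment> \<open>Ensures that the subtraction of cardinalities does not truncate.\<close>
  moreover have "card (moment_poles jl) \<le> card poles"
    using moment_poles_subset[OF assms] finite_poles by (rule card_mono[rotated])
  moreover have "r * l \<le> q * l" using r_less_q by simp
  moreover have "card (moment_poles jl) = q * l + 1" using card_moment_poles assms by (simp add: jl)
  ultimately show ?thesis by linarith
qed

text \<open>A vanishing Pochhammer factor would contradict the admissibility condition on
  \<open>a \<rho> - b j - m j + 1\<close>. The completing product omits the factor at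
  \<open>pole jl\<close>, and the other poles are distinct from it.\<close>

lemma poly_moment_numerator_diagonal:
  assumes "jl \<in> poles"
  shows "poly (moment_numerator jl) (pole jl) \<noteq> 0"
proof -
  obtain j l where jl: "jl = (j, l)" "j \<in> {1..q}" "l < m j" using assms by (auto simp: poles_def)
  have "pole jl + a \<rho> + 1 + of_nat t \<noteq> 0" if "\<rho> \<in> {1..r}" "t < l" for \<rho> t
  proof
    assume "pole jl + a \<rho> + 1 + of_nat t = 0"
    then have "a \<rho> - b j = of_nat l - of_nat t"
      by (simp add: jl(1) pole_def algebra_simps eq_diff_eq)
    \<comment> \<open>\<open>d\<close> is the distance from \<open>l\<close> to its last value
      \<open>m j - 1\<close>.\<close>
    moreover obtain d where "m j = Suc (l + d)" using jl(3) less_iff_Suc_add by blast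
    ultimately have "a \<rho> - b j - of_nat (m j) + 1 = - of_nat (d + t)"
      by simp
    then have "a \<rho> - b j - of_nat (m j) + 1 \<in> \<int>\<^sub>\<le>\<^sub>0" by (metis minus_of_nat_in_nonpos_Ints)
    moreover have "m j \<ge> 1" using jl(3) by simp
    ultimately show False using admissible jl(2) that(1) unfolding admissible_def by blast
  qed
  moreover have "pole jl - pole k \<noteq> 0" if "k \<in> poles - moment_poles jl" for k
  proof -
    have "jl \<in> moment_poles jl" using jl by (simp add: moment_poles_def)
    then have "k \<noteq> jl" using that by blast
    then show ?thesis using inj_pole assms that by (auto simp: inj_on_def)
  qed
  ultimately show ?thesis
    using finite_poles by (simp add: moment_numerator_def poly_prod jl(1) add_ac)
qed

text \<open>The only element of \<open>moment_poles (j, l)\<close> with second entry at least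
  \<open>l\<close> is \<open>(j, l)\<close> itself, so the factor at \<open>pole k\<close> belongs
  to the completing product.\<close>

lemma poly_moment_numerator_off_diagonal:
  assumes "jl \<in> poles" "k \<in> poles" "k \<noteq> jl" "snd jl \<le> snd k"
  shows "poly (moment_numerator jl) (pole k) = 0"
proof -
  have "k \<in> poles - moment_poles jl" using assms by (auto simp: moment_poles_def split: if_splits)
  then show ?thesis using finite_poles by (auto simp: moment_numerator_def poly_prod)
qed

lemma node_regular:
  assumes "is \<in> nodes"
  shows "\<rho> \<in> {1..r} \<Longrightarrow> node is + a \<rho> + 1 \<notin> \<int>\<^sub>\<le>\<^sub>0"
    and "h \<in> {1..q} \<Longrightarrow> node is + b h + 1 \<notin> \<int>\<^sub>\<le>\<^sub>0"
proof -
  obtain i s where is': "is = (i, s)" "i \<in> {1..p}" using assms by (auto simp: nodes_def)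
  have "node is + c + 1 = \<kappa> i + c + 1 + of_nat s" for c
    by (simp add: is'(1) node_def)
  then show "\<rho> \<in> {1..r} \<Longrightarrow> node is + a \<rho> + 1 \<notin> \<int>\<^sub>\<le>\<^sub>0"
    and "h \<in> {1..q} \<Longrightarrow> node is + b h + 1 \<notin> \<int>\<^sub>\<le>\<^sub>0"
    using admissible is'(2) add_of_nat_notin_nonpos_Ints unfolding admissible_def by metis+
qed

lemma node_minus_pole_nonzero:
  assumes "is \<in> nodes" "k \<in> poles"
  shows "node is - pole k \<noteq> 0"
proof -
  obtain h t where k: "k = (h, t)" "h \<in> {1..q}" using assms(2) by (auto simp: poles_def)
  have "node is - pole k = node is + b h + 1 + of_nat t" by (simp add: k(1) pole_def)
  moreover have "\<dots> \<notin> \<int>\<^sub>\<le>\<^sub>0"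
    using assms(1) k(2) by (intro add_of_nat_notin_nonpos_Ints node_regular)
  ultimately show ?thesis by (metis zero_in_nonpos_Ints)
qed

lemma common_factor_nonzero:
  assumes "is \<in> nodes"
  shows "common_factor (node is) \<noteq> 0"
  using Gamma_vec_nonzero node_regular[OF assms] node_minus_pole_nonzero[OF assms] finite_poles
  by (simp add: common_factor_def)

text \<open>Shifting the Gamma factors by \<open>l\<close> yields Pochhammer symbols, and those in
  the denominator multiply to the product over \<open>moment_poles (j, l)\<close>. Expanding by the
  remaining poles leaves a factor independent of \<open>(j, l)\<close>.\<close>

lemma weight_coeff_factorization:
  assumes "is \<in> nodes" "(j, l) \<in> poles"
  shows "weight_coeff q r a b j (of_nat l + node is) =
           common_factor (node is) * poly (moment_numerator (j, l)) (node is)"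
proof -
  let ?x = "node is" and ?\<delta> = "\<lambda>h. if h = j then 1 else 0 :: nat"
  have "Gamma_vec r (\<lambda>\<rho>. of_nat l + ?x + a \<rho> + 1) =
          (\<Prod>\<rho>=1..r. pochhammer (?x + a \<rho> + 1) l) * Gamma_vec r (\<lambda>\<rho>. ?x + a \<rho> + 1)"
    using Gamma_vec_add[of r "\<lambda>\<rho>. ?x + a \<rho> + 1" "\<lambda>_. l"] node_regular(1)[OF assms(1)]
    by (simp add: add_ac)
  also have "(\<Prod>\<rho>=1..r. pochhammer (?x + a \<rho> + 1) l) =
               poly (\<Prod>\<rho>=1..r. \<Prod>t<l. [:a \<rho> + 1 + of_nat t, 1:]) ?x"
    by (simp add: pochhammer_prod poly_prod atLeast0LessThan add_ac)
  finally have num: "Gamma_vec r (\<lambda>\<rho>. of_nat l + ?x + a \<rho> + 1) =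
     poly (\<Prod>\<rho>=1..r. \<Prod>t<l. [:a \<rho> + 1 + of_nat t, 1:]) ?x * Gamma_vec r (\<lambda>\<rho>. ?x + a \<rho> + 1)" .
  have eq: "of_nat l + ?x + b h + (if h = j then 1 else 0) + 1 = ?x + b h + 1 + of_nat (l + ?\<delta> h)" for h
    by simp
  have "Gamma_vec q (\<lambda>h. of_nat l + ?x + b h + (if h = j then 1 else 0) + 1) =
          (\<Prod>h=1..q. pochhammer (?x + b h + 1) (l + ?\<delta> h)) * Gamma_vec q (\<lambda>h. ?x + b h + 1)"
    unfolding eq by (rule Gamma_vec_add) (use node_regular(2)[OF assms(1)] in auto)
  also have "(\<Prod>h=1..q. pochhammer (?x + b h + 1) (l + ?\<delta> h)) = (\<Prod>k\<in>moment_poles (j, l). ?x - pole k)"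
    by (simp add: moment_poles_def pochhammer_prod prod.Sigma pole_def atLeast0LessThan split_def algebra_simps)
  finally have den: "Gamma_vec q (\<lambda>h. of_nat l + ?x + b h + (if h = j then 1 else 0) + 1) =
     (\<Prod>k\<in>moment_poles (j, l). ?x - pole k) * Gamma_vec q (\<lambda>h. ?x + b h + 1)" .
  have split: "(\<Prod>k\<in>poles. ?x - pole k) =
      (\<Prod>k\<in>poles - moment_poles (j, l). ?x - pole k) * (\<Prod>k\<in>moment_poles (j, l). ?x - pole k)"
    using moment_poles_subset[OF assms(2)] finite_poles by (rule prod.subset_diff)
  have "(\<Prod>k\<in>poles - moment_poles (j, l). ?x - pole k) \<noteq> 0"
    using node_minus_pole_nonzero[OF assms(1)] finite_poles by simp
  then show ?thesis
    unfolding weight_coeff_def num den common_factor_def split moment_numerator_def by (simp add: poly_prod mult_ac)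
qed

section \<open>The contour conditions as discrete orthogonality\<close>

lemma A_solutions_iff_moments:
  "A \<in> A_solutions p q r a b \<kappa> n m \<longleftrightarrow>
     (\<forall>i. i \<notin> {1..p} \<longrightarrow> A i = 0) \<and> (\<forall>i\<in>{1..p}. \<forall>s\<ge>n i. coeff (A i) s = 0) \<and>
     (\<forall>k\<in>poles. (\<Sum>is\<in>nodes. coeff (A (fst is)) (snd is) * common_factor (node is) *
        poly (moment_numerator k) (node is)) = 0)"
proof -
  have "(\<Sum>i=1..p. contour_integral (circlepath 0 1)
           (\<lambda>z. z ^ l * weight q r a b \<kappa> j i z * poly (A i) z / (2 * of_real pi * \<i>))) =
        (\<Sum>is\<in>nodes. coeff (A (fst is)) (snd is) * common_factor (node is) *
        poly (moment_numerator (j, l)) (node is))"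
    if A: "\<forall>i\<in>{1..p}. \<forall>s\<ge>n i. coeff (A i) s = 0" and jl: "(j, l) \<in> poles" for j l
  proof -
    have "(\<Sum>i=1..p. contour_integral (circlepath 0 1)
             (\<lambda>z. z ^ l * weight q r a b \<kappa> j i z * poly (A i) z / (2 * of_real pi * \<i>))) =
          (\<Sum>i=1..p. \<Sum>s<n i. coeff (A i) s * weight_coeff q r a b j (of_nat l + (\<kappa> i + of_nat s)))"
      by (intro sum.cong refl contour_integral_weight r_less_q)
         (use admissible A in \<open>auto simp: admissible_def\<close>)
    also have "\<dots> = (\<Sum>is\<in>nodes. coeff (A (fst is)) (snd is) * weight_coeff q r a b j (of_nat l + node is))"
      by (simp add: nodes_def sum.Sigma node_def split_def)
    also have "\<dots> = (\<Sum>is\<in>nodes. coeff (A (fst is)) (snd is) * common_factor (node is) *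
        poly (moment_numerator (j, l)) (node is))"
      using weight_coeff_factorization jl by (simp add: mult.assoc)
    finally show ?thesis .
  qed
  then show ?thesis
    unfolding A_solutions_def polys_upto_iff poles_def by auto
qed

text \<open>By triangularity, annihilating the moment numerators amounts to annihilating all degrees
  below \<open>card poles\<close>. With one more node than poles, only multiples of the divided
  difference do so.\<close>

lemma moments_vanish_iff:
  "(\<forall>k\<in>poles. (\<Sum>is\<in>nodes. v is * poly (moment_numerator k) (node is)) = 0) \<longleftrightarrow>
   (\<exists>c. \<forall>is\<in>nodes. v is = c / (\<Prod>k\<in>nodes - {is}. node is - node k))"
proof -
  have "(\<forall>k\<in>poles. (\<Sum>is\<in>nodes. v is * poly (moment_numerator k) (node is)) = 0) \<longleftrightarrow>
        (\<forall>P. degree P < card poles \<longrightarrow> (\<Sum>is\<in>nodes. v is * poly P (node is)) = 0)"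
    using degree_moment_numerator
      triangular_annihilator[OF finite_poles inj_pole degree_moment_numerator
        poly_moment_numerator_diagonal poly_moment_numerator_off_diagonal,
        where I = nodes and v = v and x = node]
    by blast
  then show ?thesis
    using annihilates_low_degree_iff[OF finite_nodes inj_node card_nodes] by simp
qed

section \<open>The generator of the solution space\<close>

text \<open>The divided difference weight at the node, with the common factor divided out
  again.\<close>

definition extremal_coeff :: "nat \<times> nat \<Rightarrow> complex" where
  "extremal_coeff is = 1 / (common_factor (node is) * (\<Prod>k\<in>nodes - {is}. node is - node k))"

lemma extremal_coeff_nonzero: "is \<in> nodes \<Longrightarrow> extremal_coeff is \<noteq> 0"
  using common_factor_nonzero finite_nodes inj_node by (auto simp: extremal_coeff_def inj_on_def)

definition generator :: "nat \<Rightarrow> complex poly" where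
  "generator i = (if i \<in> {1..p} then \<Sum>s<n i. monom (extremal_coeff (i, s)) s else 0)"

lemma coeff_generator: "coeff (generator i) s = (if (i, s) \<in> nodes then extremal_coeff (i, s) else 0)"
  by (simp add: generator_def nodes_def coeff_sum if_distrib cong: if_cong)

lemma A_solutions_eq: "A_solutions p q r a b \<kappa> n m = range (\<lambda>c. tuple_scale c generator)"
proof -
  have "A \<in> A_solutions p q r a b \<kappa> n m \<longleftrightarrow> (\<exists>c. A = tuple_scale c generator)" for A
  proof -
    \<comment> \<open>Vanishing of coefficients off \<open>nodes\<close> expresses both the zero
      entries outside \<open>{1..p}\<close> and the degree bounds.\<close>
    have "A \<in> A_solutions p q r a b \<kappa> n m \<longleftrightarrow>
       (\<forall>i s. (i, s) \<notin> nodes \<longrightarrow> coeff (A i) s = 0) \<and>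
       (\<exists>c. \<forall>is\<in>nodes. coeff (A (fst is)) (snd is) * common_factor (node is) =
          c / (\<Prod>k\<in>nodes - {is}. node is - node k))"
      unfolding A_solutions_iff_moments moments_vanish_iff
      by (auto simp: nodes_def poly_eq_iff not_less)
    also have "\<dots> \<longleftrightarrow> (\<forall>i s. (i, s) \<notin> nodes \<longrightarrow> coeff (A i) s = 0) \<and>
       (\<exists>c. \<forall>is\<in>nodes. coeff (A (fst is)) (snd is) = c * extremal_coeff is)"
    proof -
      have "x * common_factor (node is) =
          c / (\<Prod>k\<in>nodes - {is}. node is - node k) \<longleftrightarrow> x = c * extremal_coeff is"
        if "is \<in> nodes" for x c "is"
        using that
        by (simp add: extremal_coeff_def mult.commute common_factor_nonzero flip: nonzero_eq_divide_eq)
      then show ?thesis by simp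
    qed
    also have "\<dots> \<longleftrightarrow> (\<exists>c. A = tuple_scale c generator)"
      by (fastforce simp: tuple_scale_def fun_eq_iff poly_eq_iff coeff_generator)
    finally show ?thesis .
  qed
  then show ?thesis by blast
qed

lemma A_solutions_span: "A_solutions p q r a b \<kappa> n m = poly_tuple.span {generator}"
  by (simp add: A_solutions_eq poly_tuple.span_singleton)

lemma generator_nonzero: "generator \<noteq> 0"
proof -
  have "nodes \<noteq> {}" using card_nodes by auto
  then obtain i s where "(i, s) \<in> nodes" by auto
  then have "coeff (generator i) s \<noteq> 0" using coeff_generator extremal_coeff_nonzero by simp
  then show ?thesis by auto
qed

text \<open>Every coefficient indexed by a node is nonzero, in particular the top one at
  \<open>s = n i - 1\<close>.\<close>

lemma degree_generator:
  assumes "i \<in> {1..p}" "n i \<ge> 1"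
  shows "generator i \<noteq> 0 \<and> degree (generator i) = n i - 1"
proof -
  have nz: "coeff (generator i) (n i - 1) \<noteq> 0"
    using assms coeff_generator extremal_coeff_nonzero by (simp add: nodes_def)
  moreover have "degree (generator i) \<le> n i - 1"
    by (rule degree_le) (auto simp: coeff_generator nodes_def)
  ultimately show ?thesis using le_degree[OF nz] by auto
qed

end

section \<open>Dimension of the solution space and exact degrees\<close>

theorem proposition4p6:
  fixes p q r :: nat
    and a b \<kappa> :: "nat \<Rightarrow> complex"
    and n m :: "nat \<Rightarrow> nat"
  assumes "p \<ge> 1" and "q \<ge> 1" and "r < q"
    and "regular p q b \<kappa>"
    and "(\<Sum>i=1..p. n i) = (\<Sum>j=1..q. m j) + 1"
    and "near_diagonal q m"
    and "admissible p q r a b \<kappa> m"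
  shows "poly_tuple.subspace (A_solutions p q r a b \<kappa> n m) \<and>
         poly_tuple.dim (A_solutions p q r a b \<kappa> n m) = 1 \<and>
         (\<forall>A \<in> A_solutions p q r a b \<kappa> n m. A \<noteq> 0 \<longrightarrow>
            (\<forall>i\<in>{1..p}. n i \<ge> 1 \<longrightarrow> A i \<noteq> 0 \<and> degree (A i) = n i - 1))"
proof -
  interpret hypergeometric_A_problem p q r a b \<kappa> n m
    by unfold_locales (use assms in auto)
  have "poly_tuple.independent {generator}" using generator_nonzero by simp
  from poly_tuple.dim_span_eq_card_independent[OF this]
  have "poly_tuple.dim (A_solutions p q r a b \<kappa> n m) = 1"
    unfolding A_solutions_span by simp
  moreover have "A i \<noteq> 0 \<and> degree (A i) = n i - 1"
    if A: "A \<in> A_solutions p q r a b \<kappa> n m" "A \<noteq> 0" and i: "i \<in> {1..p}" "n i \<ge> 1" for A i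
  proof -
    obtain c where c: "A = tuple_scale c generator" using A(1) A_solutions_eq by blast
    with A(2) have "c \<noteq> 0" by auto
    then show ?thesis using degree_generator[OF i] by (simp add: c tuple_scale_def)
  qed
  ultimately show ?thesis by (simp add: A_solutions_span poly_tuple.subspace_span)
qed

end
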